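(* Let $L$ be a continuous involutive division on $\mathbb{M}$, let $\succ$ be an admissible monomial ordering, and let $F\subset R$ be a finite $L$-autoreduced set. Then $F$ is $L$-involutive (that is, $NF_L(fu,F)=0$ for all $f\in F$ and all $u\in\mathbb{M}$) if and only if the following local involutivity conditions hold: for all $f\in F$ and all $x_i\in NM_L(lm(f),lm(F))$, $NF_L(f\cdot x_i,F)=0$.
   Context: $R=K[x_1,\dots,x_n]$ with $K$ a field of characteristic zero; $\mathbb{M}$ is the monoid of monomials. $\succ$ is an admissible monomial ordering with $x_1\succ\cdots\succ x_n$; $lt(f)$, $lc(f)$, $lm(f)=lt(f)/lc(f)$ are the leading term, leading coefficient and leading monomial of $f$; $lm(F)=\{lm(f)\mid f\in F\}$. Involutive division: $L$ is given if for any finite $U\subset\mathbb{M}$ and any $u\in U$ there is given a submonoid $L(u,U)$ of $\mathbb{M}$ such that (a) if $w\in L(u,U)$ and $v\mid w$, then $v\in L(u,U)$; (b) if $u,v\in U$ and $uL(u,U)\cap vL(v,U)\ne\emptyset$, then $u\in vL(v,U)$ or $v\in uL(u,U)$; (c) if $v\in U$ and $v\in uL(u,U)$, then $L(v,U)\subseteq L(u,U)$; (d) if $V\subseteq U$, then $L(u,U)\subseteq L(u,V)$ for all $u\in V$. For $u\in U$, $u|_L w$ means $w\in uL(u,U)$. The variables in $L(u,U)$ are multiplicative for $u$; $NM_L(u,U)$ is the set of the remaining (non-multiplicative) variables. $C_L(U)=\bigcup_{u\in U}uL(u,U)$. $U$ is $L$-autoreduced if no element of $U$ is $L$-divisible (w.r.t.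 $U$) by another element of $U$. Continuity: $L$ is continuous if for any finite $U\subset\mathbb{M}$ and any finite sequence $u_1,\dots,u_k$ of elements of $U$ such that for every $i<k$ there is $x_j\in NM_L(u_i,U)$ with $u_{i+1}|_L(u_i\cdot x_j)$, one has $u_i\neq u_j$ for $i\ne j$. $L$-autoreduced polynomial set: a finite set $F$ of nonzero polynomials with pairwise distinct leading monomials such that $lm(F)$ is $L$-autoreduced and no $f\in F$ has a term with nonzero coefficient, other than $lt(f)$, whose monomial lies in $C_L(lm(F))$. Involutive reduction: $p$ is $L$-reducible modulo $f\in F$ if $p$ has a term $a\,u$ ($a\in K$, $a\neq0$, $u\in\mathbb{M}$) with $u=lm(f)v$, $v\in L(lm(f),lm(F))$; the corresponding $L$-reduction is $p\to p-(a/lc(f))\,f v$. $p$ is in $L$-normal form modulo $F$ if it is not $L$-reducible modulo any $f\in F$. $NF_L(p,F)$ denotes an $L$-normal form of $p$ modulo $F$, i.e. a polynomial in $L$-normal form modulo $F$ obtained from $p$ by a finite chain of $L$-reductions modulo $F$, chosen by an arbitrary fixed algorithm. *)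

theory Defs
  imports Main "HOL-Library.Poly_Mapping"
begin

(* A monomial is its exponent vector; the monoid of monomials is written additively, so + is the
   product of monomials and 0 is the monomial 1. The n variables are indexed by the elements of a
   finite linearly ordered type, the smallest element standing for the variable x_1. *)
type_synonym 'n mon = "'n \<Rightarrow>\<^sub>0 nat"
type_synonym ('n, 'k) mpol = "'n mon \<Rightarrow>\<^sub>0 'k"

abbreviation var_mon :: "'n \<Rightarrow> 'n mon" where
  "var_mon i \<equiv> Poly_Mapping.single i 1"

abbreviation mono_pol :: "'n mon \<Rightarrow> ('n, 'k::zero_neq_one) mpol" where
  "mono_pol u \<equiv> Poly_Mapping.single u 1"

definition mon_dvd :: "'n mon \<Rightarrow> 'n mon \<Rightarrow> bool" where
  "mon_dvd v w \<longleftrightarrow> (\<exists>t. w = v + t)"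

definition submonoid :: "'n mon set \<Rightarrow> bool" where
  "submonoid S \<longleftrightarrow> 0 \<in> S \<and> (\<forall>u\<in>S. \<forall>v\<in>S. u + v \<in> S)"

(* gt u v: the monomial u is strictly greater than v. *)
definition admissible :: "('n mon \<Rightarrow> 'n mon \<Rightarrow> bool) \<Rightarrow> bool" where
  "admissible gt \<longleftrightarrow>
     irreflp gt \<and> transp gt \<and> totalp gt \<and>
     (\<forall>u. u \<noteq> 0 \<longrightarrow> gt u 0) \<and>
     (\<forall>u v w. gt u v \<longrightarrow> gt (u + w) (v + w))"

(* Meaningful only for nonzero p. *)
definition lead_mon :: "('n mon \<Rightarrow> 'n mon \<Rightarrow> bool) \<Rightarrow> ('n, 'k::zero) mpol \<Rightarrow> 'n mon" where
  "lead_mon gt p = (THE u. u \<in> Poly_Mapping.keys p \<and>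
                           (\<forall>v\<in>Poly_Mapping.keys p. v \<noteq> u \<longrightarrow> gt u v))"

definition leadcoef :: "('n mon \<Rightarrow> 'n mon \<Rightarrow> bool) \<Rightarrow> ('n, 'k::zero) mpol \<Rightarrow> 'k" where
  "leadcoef gt p = Poly_Mapping.lookup p (lead_mon gt p)"

type_synonym 'n division = "'n mon \<Rightarrow> 'n mon set \<Rightarrow> 'n mon set"

(* The set u L(u,U). *)
definition inv_cone :: "'n division \<Rightarrow> 'n mon \<Rightarrow> 'n mon set \<Rightarrow> 'n mon set" where
  "inv_cone L u U = {u + w | w. w \<in> L u U}"

definition involutive_division :: "'n division \<Rightarrow> bool" where
  "involutive_division L \<longleftrightarrow>
     (\<forall>U. finite U \<longrightarrow>
        (\<forall>u\<in>U. submonoid (L u U)) \<and>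
        (\<forall>u\<in>U. \<forall>w v. w \<in> L u U \<and> mon_dvd v w \<longrightarrow> v \<in> L u U) \<and>
        (\<forall>u\<in>U. \<forall>v\<in>U. inv_cone L u U \<inter> inv_cone L v U \<noteq> {} \<longrightarrow>
            u \<in> inv_cone L v U \<or> v \<in> inv_cone L u U) \<and>
        (\<forall>u\<in>U. \<forall>v\<in>U. v \<in> inv_cone L u U \<longrightarrow> L v U \<subseteq> L u U) \<and>
        (\<forall>V. V \<subseteq> U \<longrightarrow> (\<forall>u\<in>V. L u U \<subseteq> L u V)))"

definition nonmult :: "'n division \<Rightarrow> 'n mon \<Rightarrow> 'n mon set \<Rightarrow> 'n set" where
  "nonmult L u U = {i. var_mon i \<notin> L u U}"

definition total_cone :: "'n division \<Rightarrow> 'n mon set \<Rightarrow> 'n mon set" where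
  "total_cone L U = (\<Union>u\<in>U. inv_cone L u U)"

definition autoreduced_mons :: "'n division \<Rightarrow> 'n mon set \<Rightarrow> bool" where
  "autoreduced_mons L U \<longleftrightarrow> (\<forall>u\<in>U. \<forall>v\<in>U. u \<noteq> v \<longrightarrow> u \<notin> inv_cone L v U)"

definition continuous_division :: "'n division \<Rightarrow> bool" where
  "continuous_division L \<longleftrightarrow>
     (\<forall>U us. finite U \<and> set us \<subseteq> U \<and>
        (\<forall>i. Suc i < length us \<longrightarrow>
           (\<exists>j\<in>nonmult L (us ! i) U. us ! i + var_mon j \<in> inv_cone L (us ! Suc i) U))
        \<longrightarrow> distinct us)"

definition autoreduced_pols ::
  "'n division \<Rightarrow> ('n mon \<Rightarrow> 'n mon \<Rightarrow> bool) \<Rightarrow> ('n, 'k::zero) mpol set \<Rightarrow> bool" where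
  "autoreduced_pols L gt F \<longleftrightarrow>
     finite F \<and> 0 \<notin> F \<and> inj_on (lead_mon gt) F \<and>
     autoreduced_mons L (lead_mon gt ` F) \<and>
     (\<forall>f\<in>F. \<forall>w\<in>Poly_Mapping.keys f.
        w \<noteq> lead_mon gt f \<longrightarrow> w \<notin> total_cone L (lead_mon gt ` F))"

definition reducible ::
  "'n division \<Rightarrow> ('n mon \<Rightarrow> 'n mon \<Rightarrow> bool) \<Rightarrow> ('n, 'k::zero) mpol set \<Rightarrow>
   ('n, 'k) mpol \<Rightarrow> ('n, 'k) mpol \<Rightarrow> bool" where
  "reducible L gt F f p \<longleftrightarrow>
     (\<exists>v\<in>L (lead_mon gt f) (lead_mon gt ` F). lead_mon gt f + v \<in> Poly_Mapping.keys p)"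

definition reduction_step ::
  "'n division \<Rightarrow> ('n mon \<Rightarrow> 'n mon \<Rightarrow> bool) \<Rightarrow> ('n, 'k::field) mpol set \<Rightarrow>
   ('n, 'k) mpol \<Rightarrow> ('n, 'k) mpol \<Rightarrow> bool" where
  "reduction_step L gt F p q \<longleftrightarrow>
     (\<exists>f\<in>F. \<exists>v\<in>L (lead_mon gt f) (lead_mon gt ` F).
        lead_mon gt f + v \<in> Poly_Mapping.keys p \<and>
        q = p - Poly_Mapping.single v
                  (Poly_Mapping.lookup p (lead_mon gt f + v) / leadcoef gt f) * f)"

definition in_normal_form ::
  "'n division \<Rightarrow> ('n mon \<Rightarrow> 'n mon \<Rightarrow> bool) \<Rightarrow> ('n, 'k::zero) mpol set \<Rightarrow>
   ('n, 'k) mpol \<Rightarrow> bool" where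
  "in_normal_form L gt F p \<longleftrightarrow> (\<forall>f\<in>F. \<not> reducible L gt F f p)"

definition normal_form_of ::
  "'n division \<Rightarrow> ('n mon \<Rightarrow> 'n mon \<Rightarrow> bool) \<Rightarrow> ('n, 'k::field) mpol set \<Rightarrow>
   ('n, 'k) mpol \<Rightarrow> ('n, 'k) mpol \<Rightarrow> bool" where
  "normal_form_of L gt F p q \<longleftrightarrow>
     (reduction_step L gt F)\<^sup>*\<^sup>* p q \<and> in_normal_form L gt F q"

(* An arbitrary normal form algorithm: NF p F is some normal form of p modulo F. *)
definition normal_form_algorithm ::
  "'n division \<Rightarrow> ('n mon \<Rightarrow> 'n mon \<Rightarrow> bool) \<Rightarrow>
   (('n, 'k::field) mpol \<Rightarrow> ('n, 'k) mpol set \<Rightarrow> ('n, 'k) mpol) \<Rightarrow> bool" where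
  "normal_form_algorithm L gt NF \<longleftrightarrow>
     (\<forall>F p. autoreduced_pols L gt F \<longrightarrow> normal_form_of L gt F p (NF p F))"

definition involutive_set ::
  "(('n, 'k::field) mpol \<Rightarrow> ('n, 'k) mpol set \<Rightarrow> ('n, 'k) mpol) \<Rightarrow> ('n, 'k) mpol set \<Rightarrow> bool" where
  "involutive_set NF F \<longleftrightarrow> (\<forall>f\<in>F. \<forall>u. NF (f * mono_pol u) F = 0)"

end

theory Submission
  imports Defs Complex_Main
begin

text \<open>
Let \<open>W\<close> be the linear span of the multiplicative products \<open>f v\<close>, where \<open>f \<in> F\<close> and
\<open>v \<in> L(lm f, lm F)\<close>. The proof replaces normal forms by membership in \<open>W\<close>:
a polynomial has normal form \<open>0\<close> if and only if it lies in \<open>W\<close>, whatever normal form algorithm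
is used. Each reduction step subtracts an element of \<open>W\<close>, so it remains to see that a
nonzero element of \<open>W\<close> is reducible (\<open>mult_span_normal_form_zero\<close>). This is where
autoreducedness enters: the involutive cones of the leading monomials are disjoint, so distinct
multiplicative products have distinct leading monomials, the greatest of which cannot cancel.

Involutivity of \<open>F\<close> thus means that \<open>f u \<in> W\<close> for all \<open>f \<in> F\<close> and all monomials \<open>u\<close>
(\<open>prolongations_in_mult_span\<close>). If \<open>u\<close> is not multiplicative for \<open>f\<close>, then it contains a
nonmultiplicative variable, \<open>u = x\<^sub>j t\<close>. Local involutivity writes \<open>f x\<^sub>j\<close> as a combination of
multiplicative products \<open>g v\<close> with \<open>lm(g) v\<close> at most \<open>lm(f) x\<^sub>j\<close>, and so \<open>f u\<close> as a combination of
the products \<open>g v t\<close>. Those with leading monomial smaller than \<open>lm(f) u\<close> are handled by induction on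
the leading monomial, since an admissible ordering is well-founded by Dickson's lemma.
If the leading monomial of \<open>g v t\<close> is still \<open>lm(f) u\<close>, then \<open>lm(g)\<close> is an involutive divisor of
\<open>lm(f) x\<^sub>j\<close>, so the passage from \<open>f\<close> to \<open>g\<close> is a link of a chain as in the definition of
continuity. Such chains cannot be continued forever in the finite set \<open>lm(F)\<close>,
which gives a second induction inside the first.
\<close>

section \<open>Well-foundedness of admissible orderings\<close>

text \<open>Every sequence in a linear order has a monotone subsequence; over the naturals a decreasing
one is constant from the index of a minimum on, hence also increasing.\<close>

lemma nat_sequence_mono_subsequence:
  fixes s :: "nat \<Rightarrow> nat"
  shows "\<exists>r. strict_mono r \<and> incseq (\<lambda>n. s (r n))"
proof -
  obtain r where r: "strict_mono r" "monoseq (\<lambda>n. s (r n))"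
    using seq_monosub[of s] by (auto simp: o_def)
  show ?thesis
  proof (cases "incseq (\<lambda>n. s (r n))")
    case True
    with r show ?thesis by blast
  next
    case False
    then have dec: "decseq (\<lambda>n. s (r n))"
      using r(2) by (simp add: monoseq_iff)
    define k where "k = (ARG_MIN (\<lambda>n. s (r n)) n. True)"
    have min: "s (r k) \<le> s (r n)" for n
      unfolding k_def by (rule arg_min_nat_le) simp
    have const: "s (r (n + k)) = s (r k)" for n
      using decseqD[OF dec, of k "n + k"] min[of "n + k"] by simp
    have "strict_mono (\<lambda>n. r (n + k))"
      using r(1) by (simp add: strict_mono_def)
    then show ?thesis
      using const by (intro exI[of _ "\<lambda>n. r (n + k)"]) (simp add: incseq_def)
  qed
qed

text \<open>The coordinates are made increasing one after the other: a subsequence of an increasing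
sequence is still increasing, so earlier coordinates are not spoiled.\<close>

lemma dickson_subsequence:
  fixes s :: "nat \<Rightarrow> 'a \<Rightarrow> nat"
  assumes "finite A"
  shows "\<exists>r. strict_mono r \<and> (\<forall>x\<in>A. incseq (\<lambda>n. s (r n) x))"
  using assms
proof (induction A)
  case empty
  show ?case by (intro exI[of _ id]) (simp add: strict_mono_def)
next
  case (insert a A)
  then obtain r where r: "strict_mono r" "\<forall>x\<in>A. incseq (\<lambda>n. s (r n) x)"
    by blast
  obtain q where q: "strict_mono q" "incseq (\<lambda>n. s (r (q n)) a)"
    using nat_sequence_mono_subsequence[of "\<lambda>n. s (r n) a"] by blast
  have "incseq (\<lambda>n. s (r (q n)) x)" if "x \<in> A" for x
    using r(2) that q(1) by (auto simp: incseq_def strict_mono_less_eq)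
  moreover have "strict_mono (\<lambda>n. r (q n))"
    using r(1) q(1) by (simp add: strict_mono_def)
  ultimately show ?case
    using q(2) by (intro exI[of _ "\<lambda>n. r (q n)"]) auto
qed

text \<open>Dickson's lemma, with divisibility of \<open>s j\<close> by \<open>s i\<close> expressed by the cofactor \<open>t\<close>.\<close>

lemma dickson:
  fixes s :: "nat \<Rightarrow> 'n::finite mon"
  obtains i j t where "i < j" "s j = s i + t"
proof -
  obtain r where r: "strict_mono r"
      "\<And>x. incseq (\<lambda>n. Poly_Mapping.lookup (s (r n)) x)"
    using dickson_subsequence[OF finite_UNIV, of "\<lambda>n. Poly_Mapping.lookup (s n)"] by auto
  have "Poly_Mapping.lookup (s (r 0)) x \<le> Poly_Mapping.lookup (s (r 1)) x" for x
    using r(2)[of x] by (simp add: incseq_def)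
  then have "s (r 1) = s (r 0) + (s (r 1) - s (r 0))"
    by (intro poly_mapping_eqI) (simp add: lookup_add lookup_minus)
  moreover have "r 0 < r 1"
    using r(1) by (simp add: strict_mono_def)
  ultimately show thesis using that by blast
qed

text \<open>In an infinite descending sequence some element would divide a later, hence smaller, one; but
in an admissible ordering a multiple is never smaller.\<close>

lemma wf_admissible:
  fixes gt :: "'n::finite mon \<Rightarrow> 'n mon \<Rightarrow> bool"
  assumes "admissible gt"
  shows "wf {(v, u). gt u v}"
  unfolding wf_iff_no_infinite_down_chain
proof (rule notI, elim exE)
  fix s assume s: "\<forall>i. (s (Suc i), s i) \<in> {(v, u). gt u v}"
  have irr: "\<not> gt u u" and tr: "gt u v \<Longrightarrow> gt v w \<Longrightarrow> gt u w"
    and pos: "u \<noteq> 0 \<Longrightarrow> gt u 0" and mono: "gt u v \<Longrightarrow> gt (u + w) (v + w)" for u v w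
    using assms by (auto simp: admissible_def irreflp_def dest: transpD)
  obtain i j t where ij: "i < j" "s j = s i + t"
    by (rule dickson)
  have "gt (s i) (s j)"
    using ij(1) by (induction rule: less_Suc_induct) (use s tr in blast)+
  moreover have "s j = s i \<or> gt (s j) (s i)"
    using pos[of t] mono[of t 0 "s i"] ij(2) by (cases "t = 0") (auto simp: add.commute)
  ultimately show False
    using irr tr by metis
qed

section \<open>Chains of a continuous division\<close>

text \<open>Continuity makes the elements of every chain distinct, so a chain in \<open>U\<close> has at most
\<open>card U\<close> elements; this bound is what turns continuity into an induction principle.\<close>

lemma wf_continuous_division:
  assumes "continuous_division L" and "finite U"
  shows "wf {(v, u). u \<in> U \<and> v \<in> U \<and> (\<exists>j\<in>nonmult L u U. u + var_mon j \<in> inv_cone L v U)}"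
  unfolding wf_iff_no_infinite_down_chain
proof (rule notI, elim exE)
  fix s
  assume s: "\<forall>i. (s (Suc i), s i) \<in>
    {(v, u). u \<in> U \<and> v \<in> U \<and> (\<exists>j\<in>nonmult L u U. u + var_mon j \<in> inv_cone L v U)}"
  define us where "us = map s [0..<Suc (card U)]"
  have nth: "us ! i = s i" if "i < length us" for i
    using that by (simp add: us_def del: upt_Suc)
  have sub: "set us \<subseteq> U"
    using s by (auto simp: us_def)
  have "\<exists>j\<in>nonmult L (us ! i) U. us ! i + var_mon j \<in> inv_cone L (us ! Suc i) U"
    if "Suc i < length us" for i
    using s that nth[of i] nth[of "Suc i"] by auto
  then have "distinct us"
    using assms sub unfolding continuous_division_def by blast
  then have "card (set us) = Suc (card U)"
    using distinct_card[of us] by (simp add: us_def del: upt_Suc)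
  then show False
    using card_mono[OF \<open>finite U\<close> sub] by simp
qed

section \<open>Involutive reduction\<close>

lemma sum_monomials:
  fixes p :: "'a \<Rightarrow>\<^sub>0 'b::comm_monoid_add"
  shows "(\<Sum>k\<in>Poly_Mapping.keys p. Poly_Mapping.single k (Poly_Mapping.lookup p k)) = p"
  by (rule poly_mapping_eqI) (auto simp: lookup_sum lookup_single when_def in_keys_iff)

locale involutive_system =
  fixes L :: "'n::finite division"
    and gt :: "'n mon \<Rightarrow> 'n mon \<Rightarrow> bool"
    and F :: "('n, 'k::field) mpol set"
  assumes division: "involutive_division L"
    and admissible: "admissible gt"
    and autoreduced: "autoreduced_pols L gt F"
begin

abbreviation lm :: "('n, 'k) mpol \<Rightarrow> 'n mon" where
  "lm \<equiv> lead_mon gt"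

abbreviation mult :: "('n, 'k) mpol \<Rightarrow> 'n mon set" where
  "mult f \<equiv> L (lm f) (lm ` F)"

abbreviation le :: "'n mon \<Rightarrow> 'n mon \<Rightarrow> bool" where
  "le v u \<equiv> v = u \<or> gt u v"

lemma gt_irrefl: "\<not> gt u u"
  and gt_trans: "gt u v \<Longrightarrow> gt v w \<Longrightarrow> gt u w"
  and gt_total: "u \<noteq> v \<Longrightarrow> gt u v \<or> gt v u"
  and gt_add: "gt u v \<Longrightarrow> gt (u + w) (v + w)"
  using admissible by (auto simp: admissible_def irreflp_def totalp_on_def dest: transpD)

lemma finite_F: "finite F" and finite_lm: "finite (lm ` F)"
  using autoreduced by (simp_all add: autoreduced_pols_def)

lemma submonoid_mult: "f \<in> F \<Longrightarrow> submonoid (mult f)"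
  using division[unfolded involutive_division_def, rule_format, OF finite_lm] by simp

lemma overlapping_cones:
  assumes "u \<in> lm ` F" "v \<in> lm ` F"
    and "m \<in> inv_cone L u (lm ` F)" "m \<in> inv_cone L v (lm ` F)"
  shows "u \<in> inv_cone L v (lm ` F) \<or> v \<in> inv_cone L u (lm ` F)"
proof -
  have "\<forall>u\<in>lm ` F. \<forall>v\<in>lm ` F. inv_cone L u (lm ` F) \<inter> inv_cone L v (lm ` F) \<noteq> {} \<longrightarrow>
      u \<in> inv_cone L v (lm ` F) \<or> v \<in> inv_cone L u (lm ` F)"
    using division[unfolded involutive_division_def, rule_format, OF finite_lm] by (elim conjE)
  moreover have "inv_cone L u (lm ` F) \<inter> inv_cone L v (lm ` F) \<noteq> {}"
    using assms(3,4) by (metis IntI empty_iff)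
  ultimately show ?thesis
    using assms(1,2) by metis
qed

lemma exists_greatest:
  assumes "finite A" "A \<noteq> {}"
  shows "\<exists>u\<in>A. \<forall>v\<in>A. v \<noteq> u \<longrightarrow> gt u v"
  using assms
proof (induction A rule: finite_ne_induct)
  case (insert a A)
  then obtain u where "u \<in> A" "\<forall>v\<in>A. v \<noteq> u \<longrightarrow> gt u v" by blast
  then show ?case
    using gt_total[of a u] gt_trans by (metis insert_iff)
qed simp

lemma lead_mon_greatest:
  assumes "p \<noteq> 0"
  shows "lm p \<in> Poly_Mapping.keys p" and "v \<in> Poly_Mapping.keys p \<Longrightarrow> le v (lm p)"
proof -
  have "\<exists>!u. u \<in> Poly_Mapping.keys p \<and> (\<forall>v\<in>Poly_Mapping.keys p. v \<noteq> u \<longrightarrow> gt u v)"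
    using exists_greatest[of "Poly_Mapping.keys p"] assms gt_irrefl gt_trans
    by (simp add: Ex1_def) metis
  from theI'[OF this] show "lm p \<in> Poly_Mapping.keys p"
    and "v \<in> Poly_Mapping.keys p \<Longrightarrow> le v (lm p)"
    unfolding lead_mon_def by blast+
qed

lemma nonzero: "f \<in> F \<Longrightarrow> f \<noteq> 0"
  using autoreduced by (auto simp: autoreduced_pols_def)

text \<open>Cancellation of exponent vectors leaves a single term of the convolution.\<close>

lemma lookup_mult_single:
  fixes f :: "('n, 'k) mpol"
  shows "Poly_Mapping.lookup (Poly_Mapping.single v c * f) (v + w) = c * Poly_Mapping.lookup f w"
proof -
  have "Poly_Mapping.lookup (Poly_Mapping.single v c * f) (v + w) =
        c * Sum_any (\<lambda>q. Poly_Mapping.lookup f q when v + w = v + q)"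
    by (simp add: lookup_mult lookup_single when_mult)
  also have "Sum_any (\<lambda>q. Poly_Mapping.lookup f q when v + w = v + q) = Poly_Mapping.lookup f w"
    by simp
  finally show ?thesis .
qed

lemma keys_mult_single_le:
  assumes "f \<in> F" and "u \<in> Poly_Mapping.keys (Poly_Mapping.single v c * f)"
  shows "le u (lm f + v)"
proof -
  obtain a b where ab: "u = a + b" "a \<in> Poly_Mapping.keys (Poly_Mapping.single v c)"
      "b \<in> Poly_Mapping.keys f"
    using assms(2) keys_mult by blast
  then have "u = b + v"
    by (auto simp: add.commute split: if_splits)
  moreover have "le b (lm f)"
    using lead_mon_greatest(2)[OF nonzero[OF assms(1)] ab(3)] .
  ultimately show ?thesis
    using gt_add by blast
qed

text \<open>Overlapping cones would make one of the leading monomials an involutive divisor of the other,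
which autoreducedness excludes unless the two polynomials coincide.\<close>

lemma cones_disjoint:
  assumes "f \<in> F" "g \<in> F" "v \<in> mult f" "w \<in> mult g" "lm f + v = lm g + w"
  shows "f = g \<and> v = w"
proof -
  have "lm f + v \<in> inv_cone L (lm f) (lm ` F)" "lm f + v \<in> inv_cone L (lm g) (lm ` F)"
    using assms(3,4,5) unfolding inv_cone_def by blast+
  then have "lm f \<in> inv_cone L (lm g) (lm ` F) \<or> lm g \<in> inv_cone L (lm f) (lm ` F)"
    using overlapping_cones assms(1,2) by (metis imageI)
  then have "lm f = lm g"
    using autoreduced assms(1,2) unfolding autoreduced_pols_def autoreduced_mons_def
    by (metis imageI)
  then show ?thesis
    using autoreduced assms by (auto simp: autoreduced_pols_def dest: inj_onD)
qed

text \<open>Collecting the multipliers of each \<open>f\<close> into one polynomial \<open>h f\<close> describes the linear span of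
the multiplicative products without reference to a finite list of them.\<close>

definition mult_span :: "('n, 'k) mpol set" where
  "mult_span = {\<Sum>f\<in>F. h f * f | h. \<forall>f\<in>F. Poly_Mapping.keys (h f) \<subseteq> mult f}"

lemma mult_span_zero: "0 \<in> mult_span"
  unfolding mult_span_def by (auto intro!: exI[of _ "\<lambda>_. 0"])

lemma mult_span_add:
  assumes "p \<in> mult_span" "q \<in> mult_span"
  shows "p + q \<in> mult_span"
proof -
  obtain h where h: "p = (\<Sum>f\<in>F. h f * f)" "\<forall>f\<in>F. Poly_Mapping.keys (h f) \<subseteq> mult f"
    using assms(1) unfolding mult_span_def by auto
  obtain h' where h': "q = (\<Sum>f\<in>F. h' f * f)" "\<forall>f\<in>F. Poly_Mapping.keys (h' f) \<subseteq> mult f"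
    using assms(2) unfolding mult_span_def by auto
  have "p + q = (\<Sum>f\<in>F. (h f + h' f) * f)"
    using h(1) h'(1) by (simp add: sum.distrib distrib_right)
  moreover have "\<forall>f\<in>F. Poly_Mapping.keys (h f + h' f) \<subseteq> mult f"
    by (intro ballI order_trans[OF Poly_Mapping.keys_add] Un_least) (use h(2) h'(2) in simp_all)
  ultimately show ?thesis
    unfolding mult_span_def by (intro CollectI exI[of _ "\<lambda>f. h f + h' f"]) simp
qed

lemma mult_span_single:
  assumes "f \<in> F" "v \<in> mult f"
  shows "Poly_Mapping.single v c * f \<in> mult_span"
proof -
  have "Poly_Mapping.single v c * f =
      (\<Sum>g\<in>F. (if g = f then Poly_Mapping.single v c else 0) * g)"
    using assms(1) finite_F by (simp add: if_distrib[of "\<lambda>x. x * _"] cong: if_cong)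
  then show ?thesis
    using assms(2) unfolding mult_span_def
    by (intro CollectI exI[of _ "\<lambda>g. if g = f then Poly_Mapping.single v c else 0"]) auto
qed

text \<open>Among the multiplicative products that occur in \<open>p\<close>, a single one has the greatest leading
monomial \<open>m\<close>, since the cones are disjoint. No other product contains \<open>m\<close>, so \<open>m\<close> survives in \<open>p\<close>,
and the product that contributes it reduces \<open>p\<close>.\<close>

lemma mult_span_normal_form_zero:
  assumes "p \<in> mult_span" and "in_normal_form L gt F p"
  shows "p = 0"
proof (rule ccontr)
  assume "p \<noteq> 0"
  obtain h where h: "p = (\<Sum>f\<in>F. h f * f)" "\<And>f. f \<in> F \<Longrightarrow> Poly_Mapping.keys (h f) \<subseteq> mult f"
    using assms(1) unfolding mult_span_def by auto
  define S where "S = (SIGMA f:F. Poly_Mapping.keys (h f))"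
  have finS: "finite S"
    using finite_F by (simp add: S_def)
  have expand: "h f * f =
      (\<Sum>v\<in>Poly_Mapping.keys (h f). Poly_Mapping.single v (Poly_Mapping.lookup (h f) v) * f)" for f
    by (simp add: sum_monomials flip: sum_distrib_right)
  have p: "p = (\<Sum>(f, v)\<in>S. Poly_Mapping.single v (Poly_Mapping.lookup (h f) v) * f)"
    unfolding h(1) S_def using finite_F expand by (subst sum.Sigma[symmetric]) auto
  with \<open>p \<noteq> 0\<close> have "S \<noteq> {}" by auto
  then obtain m where m: "m \<in> (\<lambda>(f, v). lm f + v) ` S"
      "\<forall>u \<in> (\<lambda>(f, v). lm f + v) ` S. u \<noteq> m \<longrightarrow> gt m u"
    using exists_greatest[of "(\<lambda>(f, v). lm f + v) ` S"] finS by auto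
  then obtain g w where gw: "(g, w) \<in> S" "m = lm g + w" by auto
  have other: "Poly_Mapping.lookup (Poly_Mapping.single v c * f) m = 0"
    if "(f, v) \<in> S" "(f, v) \<noteq> (g, w)" for f v c
  proof (rule ccontr)
    assume "Poly_Mapping.lookup (Poly_Mapping.single v c * f) m \<noteq> 0"
    then have "le m (lm f + v)"
      using that(1) by (intro keys_mult_single_le) (auto simp: S_def in_keys_iff)
    moreover have "le (lm f + v) m"
      using m(2) that(1) by force
    ultimately have "lm f + v = lm g + w"
      using gt_irrefl gt_trans gw(2) by metis
    then show False
      using cones_disjoint[of f g v w] that gw(1) h(2) by (auto simp: S_def)
  qed
  have "Poly_Mapping.lookup p m =
      (\<Sum>(f, v)\<in>S. Poly_Mapping.lookup (Poly_Mapping.single v (Poly_Mapping.lookup (h f) v) * f) m)"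
    by (subst p) (simp add: lookup_sum split_def)
  also have "\<dots> = Poly_Mapping.lookup (Poly_Mapping.single w (Poly_Mapping.lookup (h g) w) * g) m"
    by (subst sum.remove[OF finS gw(1)]) (auto intro!: sum.neutral other)
  also have "\<dots> = Poly_Mapping.lookup (h g) w * Poly_Mapping.lookup g (lm g)"
    using lookup_mult_single[of w _ g "lm g"] by (simp add: gw(2) add.commute)
  also have "\<dots> \<noteq> 0"
    using gw(1) lead_mon_greatest(1)[of g] nonzero by (auto simp: S_def in_keys_iff)
  finally have "lm g + w \<in> Poly_Mapping.keys p"
    by (simp add: in_keys_iff gw(2))
  moreover have "g \<in> F" "w \<in> mult g"
    using gw(1) h(2) by (auto simp: S_def)
  ultimately show False
    using assms(2) by (auto simp: in_normal_form_def reducible_def)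
qed

lemma mult_span_reduction:
  assumes "(reduction_step L gt F)\<^sup>*\<^sup>* p q" and "p \<in> mult_span"
  shows "q \<in> mult_span"
  using assms
proof (induction rule: rtranclp_induct)
  case (step q r)
  then obtain f v where "f \<in> F" "v \<in> mult f"
      "r = q - Poly_Mapping.single v (Poly_Mapping.lookup q (lm f + v) / leadcoef gt f) * f"
    unfolding reduction_step_def by blast
  then have "r = q + Poly_Mapping.single v
      (- (Poly_Mapping.lookup q (lm f + v) / leadcoef gt f)) * f"
    by (simp add: single_uminus)
  with step \<open>f \<in> F\<close> \<open>v \<in> mult f\<close> show ?case
    using mult_span_add mult_span_single by blast
qed

lemma normal_form_zero_if_mult_span:
  assumes "normal_form_of L gt F p q" and "p \<in> mult_span"
  shows "q = 0"
  using assms mult_span_reduction mult_span_normal_form_zero unfolding normal_form_of_def by blast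

text \<open>A reduction of \<open>p\<close> to \<open>0\<close> writes \<open>p\<close> as a sum of multiplicative products. The leading
monomial of each of them is a monomial of the polynomial being reduced, so a bound \<open>b\<close> on the
monomials of \<open>p\<close> is inherited by all these products and by all intermediate polynomials. Phrased as
an induction rule, this applies to any additively closed property.\<close>

lemma reduction_to_zero_induct [consumes 1, case_names bound zero add single]:
  assumes "(reduction_step L gt F)\<^sup>*\<^sup>* p 0"
    and bound: "\<And>u. u \<in> Poly_Mapping.keys p \<Longrightarrow> le u b"
    and zero: "P 0"
    and add: "\<And>q r. P q \<Longrightarrow> P r \<Longrightarrow> P (q + r)"
    and single: "\<And>f v c. f \<in> F \<Longrightarrow> v \<in> mult f \<Longrightarrow> le (lm f + v) b \<Longrightarrow>
                   P (Poly_Mapping.single v c * f)"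
  shows "P p"
  using assms(1,2)
proof (induction rule: converse_rtranclp_induct)
  case base
  show ?case by (fact zero)
next
  case (step p q)
  then obtain f v where fv: "f \<in> F" "v \<in> mult f" "lm f + v \<in> Poly_Mapping.keys p"
      and q: "q = p - Poly_Mapping.single v (Poly_Mapping.lookup p (lm f + v) / leadcoef gt f) * f"
    unfolding reduction_step_def by blast
  define t where
    "t = Poly_Mapping.single v (Poly_Mapping.lookup p (lm f + v) / leadcoef gt f) * f"
  have b: "le (lm f + v) b"
    using step.prems fv(3) by blast
  have "le u b" if u: "u \<in> Poly_Mapping.keys q" for u
  proof -
    consider "u \<in> Poly_Mapping.keys p" | "u \<in> Poly_Mapping.keys t"
      using u keys_diff[of p t] unfolding q t_def by blast
    then show ?thesis
    proof cases
      case 1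
      then show ?thesis by (rule step.prems)
    next
      case 2
      then have "le u (lm f + v)"
        unfolding t_def by (rule keys_mult_single_le[OF fv(1)])
      then show ?thesis using b gt_trans by metis
    qed
  qed
  then have "P q"
    by (rule step.IH)
  then have "P (q + t)"
    using single[OF fv(1,2) b] unfolding t_def by (rule add)
  then show ?case
    by (simp add: q t_def)
qed

text \<open>The multiplicative monomials form a submonoid, which contains all products of its variables.\<close>

lemma mult_if_no_nonmult_variable:
  assumes "f \<in> F"
    and "\<And>j. j \<in> Poly_Mapping.keys u \<Longrightarrow> var_mon j \<in> mult f"
  shows "u \<in> mult f"
proof -
  note sm = submonoid_mult[OF assms(1)]
  have power: "Poly_Mapping.single j k \<in> mult f" if "var_mon j \<in> mult f" for j k
  proof (induction k)
    case 0
    show ?case using sm by (simp add: submonoid_def)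
  next
    case (Suc k)
    have "Poly_Mapping.single j (Suc k) = var_mon j + Poly_Mapping.single j k"
      by (simp flip: single_add)
    then show ?case using sm Suc that by (simp add: submonoid_def)
  qed
  have "(\<Sum>j\<in>A. Poly_Mapping.single j (Poly_Mapping.lookup u j)) \<in> mult f"
    if "A \<subseteq> Poly_Mapping.keys u" for A
    using finite_subset[OF that finite_keys] that
    by (induction A) (use sm power assms(2) in \<open>auto simp: submonoid_def\<close>)
  then show ?thesis
    using sum_monomials[of u] by (metis subset_refl)
qed

text \<open>The outer induction is on \<open>lm f + u\<close> along the ordering, the inner one on \<open>lm g\<close> along
the chains of the division, over all \<open>g\<close> and \<open>u'\<close> with \<open>lm g + u' = lm f + u\<close>.\<close>

lemma prolongations_in_mult_span:
  assumes cont: "continuous_division L"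
    and local: "\<And>f j. f \<in> F \<Longrightarrow> j \<in> nonmult L (lm f) (lm ` F) \<Longrightarrow>
                  (reduction_step L gt F)\<^sup>*\<^sup>* (f * mono_pol (var_mon j)) 0"
    and "f \<in> F"
  shows "Poly_Mapping.single u c * f \<in> mult_span"
  using \<open>f \<in> F\<close>
proof (induction "lm f + u" arbitrary: f u c rule: wf_induct_rule[OF wf_admissible[OF admissible]])
  case outer: 1
  have "Poly_Mapping.single u' c * g \<in> mult_span"
    if "g \<in> F" "lm g + u' = lm f + u" for g u' c
    using that
  proof (induction "lm g" arbitrary: g u' c
      rule: wf_induct_rule[OF wf_continuous_division[OF cont finite_lm]])
    case inner: 1
    show ?case
    proof (cases "u' \<in> mult g")
      case True
      then show ?thesis using mult_span_single inner.prems by blast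
    next
      case False
      then obtain j where j: "j \<in> Poly_Mapping.keys u'" "j \<in> nonmult L (lm g) (lm ` F)"
        using mult_if_no_nonmult_variable[OF inner.prems(1)] by (auto simp: nonmult_def)
      define t where "t = u' - var_mon j"
      have t: "u' = var_mon j + t"
        using j(1) unfolding t_def
        by (intro poly_mapping_eqI) (auto simp: lookup_add lookup_minus lookup_single when_def in_keys_iff)
      \<comment> \<open>Local involutivity expands the factor \<open>g x\<^sub>j\<close>; every summand is then multiplied by \<open>t\<close>.\<close>
      have "Poly_Mapping.single t c * (g * mono_pol (var_mon j)) \<in> mult_span"
        using local[OF inner.prems(1) j(2)]
      proof (induction rule: reduction_to_zero_induct[where b = "lm g + var_mon j"
            and P = "\<lambda>q. Poly_Mapping.single t c * q \<in> mult_span"])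
        case (bound v)
        then show ?case
          using keys_mult_single_le[OF inner.prems(1)] by (simp add: mult.commute)
      next
        case zero
        show ?case by (simp add: mult_span_zero)
      next
        case (add q r)
        then show ?case by (simp add: distrib_left mult_span_add)
      next
        case (single h v d)
        have eq: "Poly_Mapping.single t c * (Poly_Mapping.single v d * h) =
            Poly_Mapping.single (v + t) (c * d) * h"
          by (simp add: mult_single add.commute flip: mult.assoc)
        show ?case
        proof (cases "lm h + v = lm g + var_mon j")
          case True
          \<comment> \<open>The leading monomial does not drop, but \<open>lm h\<close> is the next element of a chain after \<open>lm g\<close>.\<close>
          have "lm h + (v + t) = lm f + u"
            using True inner.prems(2) t by (simp flip: add.assoc)
          moreover have "lm g + var_mon j \<in> inv_cone L (lm h) (lm ` F)"
            using True[symmetric] single(2) by (auto simp: inv_cone_def)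
          ultimately show ?thesis
            unfolding eq using inner.hyps inner.prems(1) single(1) j(2) by blast
        next
          case False
          then have "gt (lm g + var_mon j) (lm h + v)"
            using single(3) by blast
          then have "gt (lm f + u) (lm h + (v + t))"
            using gt_add[of "lm g + var_mon j" "lm h + v" t] inner.prems(2) t
            by (simp add: add.assoc)
          then show ?thesis
            unfolding eq using outer.hyps single(1) by blast
        qed
      qed
      moreover have "Poly_Mapping.single u' c * g =
          Poly_Mapping.single t c * (g * mono_pol (var_mon j))"
        by (simp add: t mult_single mult.left_commute mult.commute add.commute flip: mult.assoc)
      ultimately show ?thesis by simp
    qed
  qed
  then show ?case using outer.prems by blast
qed

end

section \<open>Local involutivity\<close>

theorem theorem6p5:
  fixes L :: "'n::{finite, linorder} division"
    and gt :: "'n mon \<Rightarrow> 'n mon \<Rightarrow> bool"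
    and NF :: "('n, 'k::field_char_0) mpol \<Rightarrow> ('n, 'k) mpol set \<Rightarrow> ('n, 'k) mpol"
    and F :: "('n, 'k) mpol set"
  assumes "involutive_division L"
    and "continuous_division L"
    and "admissible gt"
    and "\<And>i j. i < j \<Longrightarrow> gt (var_mon i) (var_mon j)"
    and "normal_form_algorithm L gt NF"
    and "autoreduced_pols L gt F"
  shows "involutive_set NF F \<longleftrightarrow>
    (\<forall>f\<in>F. \<forall>i\<in>nonmult L (lead_mon gt f) (lead_mon gt ` F).
       NF (f * mono_pol (var_mon i)) F = 0)"
proof
  assume "involutive_set NF F"
  then show "\<forall>f\<in>F. \<forall>i\<in>nonmult L (lead_mon gt f) (lead_mon gt ` F).
       NF (f * mono_pol (var_mon i)) F = 0"
    by (simp add: involutive_set_def)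
next
  assume local: "\<forall>f\<in>F. \<forall>i\<in>nonmult L (lead_mon gt f) (lead_mon gt ` F).
       NF (f * mono_pol (var_mon i)) F = 0"
  interpret involutive_system L gt F
    using assms(1,3,6) by (rule involutive_system.intro)
  have NF: "normal_form_of L gt F p (NF p F)" for p
    using assms(5,6) by (simp add: normal_form_algorithm_def)
  have "(reduction_step L gt F)\<^sup>*\<^sup>* (f * mono_pol (var_mon j)) 0"
    if "f \<in> F" "j \<in> nonmult L (lead_mon gt f) (lead_mon gt ` F)" for f j
  proof -
    have "NF (f * mono_pol (var_mon j)) F = 0"
      using local that by blast
    then show ?thesis
      using NF[of "f * mono_pol (var_mon j)"] unfolding normal_form_of_def by metis
  qed
  then have "mono_pol u * f \<in> mult_span" if "f \<in> F" for f u
    using prolongations_in_mult_span[OF assms(2)] that by blast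
  then have "NF (f * mono_pol u) F = 0" if "f \<in> F" for f u
    using normal_form_zero_if_mult_span[OF NF] that by (metis mult.commute)
  then show "involutive_set NF F"
    by (simp add: involutive_set_def)
qed

end
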